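(* Let $n\geq 5$ and let $G$ be a connected simple graph of order $n$ having some normalized Laplacian eigenvalue of multiplicity exactly $n-3$. Let $\rho_1(G)\geq \rho_2(G)\geq\cdots\geq\rho_{n-1}(G)>\rho_n(G)=0$ be the normalized Laplacian eigenvalues of $G$. Then $G$ contains an induced path $P_4$, satisfies $\rho_{n-1}(G)\neq 1$, and has independence number $\nu(G)=2$ and diameter $\mathrm{diam}(G)=2$, if and only if $G$ is isomorphic to the cycle $C_5$.
   Context: For a graph $G$ with degree diagonal matrix $D(G)$ (all degrees positive) and adjacency matrix $A(G)$, the normalized Laplacian matrix is $\mathcal{L}(G)=I-D(G)^{-1/2}A(G)D(G)^{-1/2}$, i.e. the entry at $(u,v)$ is $1$ if $u=v$, $-1/\sqrt{d_ud_v}$ if $u\sim v$, and $0$ otherwise, where $d_u$ is the degree of $u$. Its eigenvalues are the normalized Laplacian eigenvalues; for a connected graph, $0$ is an eigenvalue of multiplicity $1$ and is the smallest. The independence number $\nu(G)$ is the maximum size of a set of pairwise nonadjacent vertices. *)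

theory Defs
  imports "HOL-Analysis.Analysis" "HOL-Computational_Algebra.Polynomial"
begin

text \<open>A graph is given by its adjacency relation; its vertices are all elements of a finite
  type, so that matrices indexed by the vertices are available directly.\<close>

definition simple_graph :: "('v \<Rightarrow> 'v \<Rightarrow> bool) \<Rightarrow> bool" where
  "simple_graph E \<longleftrightarrow> symp E \<and> irreflp E"

definition connected_graph :: "('v \<Rightarrow> 'v \<Rightarrow> bool) \<Rightarrow> bool" where
  "connected_graph E \<longleftrightarrow> (\<forall>u v. E\<^sup>*\<^sup>* u v)"

definition degree_of :: "('v::finite \<Rightarrow> 'v \<Rightarrow> bool) \<Rightarrow> 'v \<Rightarrow> nat" where
  "degree_of E u = card {v. E u v}"

definition graph_dist :: "('v \<Rightarrow> 'v \<Rightarrow> bool) \<Rightarrow> 'v \<Rightarrow> 'v \<Rightarrow> nat" where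
  "graph_dist E u v = (LEAST k. (E ^^ k) u v)"

definition graph_diameter :: "('v::finite \<Rightarrow> 'v \<Rightarrow> bool) \<Rightarrow> nat" where
  "graph_diameter E = Max {graph_dist E u v | u v. True}"

definition independent_set :: "('v \<Rightarrow> 'v \<Rightarrow> bool) \<Rightarrow> 'v set \<Rightarrow> bool" where
  "independent_set E S \<longleftrightarrow> (\<forall>u\<in>S. \<forall>v\<in>S. \<not> E u v)"

definition independence_number :: "('v::finite \<Rightarrow> 'v \<Rightarrow> bool) \<Rightarrow> nat" where
  "independence_number E = Max {card S | S. independent_set E S}"

definition path_adj :: "nat \<Rightarrow> nat \<Rightarrow> bool" where
  "path_adj i j \<longleftrightarrow> j = Suc i \<or> i = Suc j"

definition cycle_adj :: "nat \<Rightarrow> nat \<Rightarrow> nat \<Rightarrow> bool" where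
  "cycle_adj k i j \<longleftrightarrow> j = Suc i mod k \<or> i = Suc j mod k"

text \<open>The path and the cycle on \<open>k\<close> vertices have vertex set \<open>{..<k}\<close>.\<close>

definition has_induced_path :: "nat \<Rightarrow> ('v \<Rightarrow> 'v \<Rightarrow> bool) \<Rightarrow> bool" where
  "has_induced_path k E \<longleftrightarrow>
     (\<exists>p. inj_on p {..<k} \<and> (\<forall>i<k. \<forall>j<k. E (p i) (p j) \<longleftrightarrow> path_adj i j))"

definition isomorphic_to_cycle :: "nat \<Rightarrow> ('v \<Rightarrow> 'v \<Rightarrow> bool) \<Rightarrow> bool" where
  "isomorphic_to_cycle k E \<longleftrightarrow>
     (\<exists>f. bij_betw f UNIV {..<k} \<and> (\<forall>u v. E u v \<longleftrightarrow> cycle_adj k (f u) (f v)))"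

definition normalized_laplacian :: "('v::finite \<Rightarrow> 'v \<Rightarrow> bool) \<Rightarrow> real ^ 'v ^ 'v" where
  "normalized_laplacian E =
     (\<chi> u v. if u = v then 1
            else if E u v then - 1 / sqrt (real (degree_of E u) * real (degree_of E v))
            else 0)"

definition charpoly :: "real ^ 'n ^ 'n \<Rightarrow> real poly" where
  "charpoly A = det (mat [:0, 1:] - (\<chi> i j. [:A $ i $ j:]))"

text \<open>The eigenvalues, with multiplicity, are the roots of the characteristic polynomial. For a
  simple graph the normalized Laplacian is a real symmetric matrix, so this polynomial splits over
  the reals and algebraic and geometric multiplicities agree.\<close>

definition nl_spectrum :: "('v::finite \<Rightarrow> 'v \<Rightarrow> bool) \<Rightarrow> real multiset" where
  "nl_spectrum E = proots (charpoly (normalized_laplacian E))"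

text \<open>\<open>nl_eigenvalue E i\<close> is the \<open>i\<close>-th largest eigenvalue, for \<open>i\<close> from \<open>1\<close> to the number of
  vertices.\<close>

definition nl_eigenvalue :: "('v::finite \<Rightarrow> 'v \<Rightarrow> bool) \<Rightarrow> nat \<Rightarrow> real" where
  "nl_eigenvalue E i = rev (sorted_list_of_multiset (nl_spectrum E)) ! (i - 1)"

end

theory Submission
  imports Defs
begin

text \<open>Let \<open>\<theta>\<close> have multiplicity \<open>n - 3\<close> and put \<open>l = 1 - \<theta>\<close>. The normalized Laplacian \<open>L\<close> is
  symmetric, so \<open>A - l D\<close>, which is congruent to \<open>\<theta> I - L\<close>, has rank \<open>3\<close>. For an induced path \<open>a b c d\<close> the
  rows of \<open>a, b, c\<close> are independent because of the triangular minor in the columns \<open>b, c, d\<close>.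
  Hence every entry of \<open>A - l D\<close> is an explicit expression in the adjacencies to the path and in
  \<open>l\<close> times the degrees along it. As no three vertices are independent, a vertex outside the path
  is attached to it in one of few ways; each way forces equations between the four degrees, and
  these equations, together with the degree bounds coming from diameter \<open>2\<close>, leave only \<open>C\<^sub>5\<close>.\<close>

subsection \<open>Multiplicities of eigenvalues of symmetric matrices\<close>

lemma symmetric_inner:
  fixes A :: "real^'n^'n"
  assumes "transpose A = A"
  shows "(A *v x) \<bullet> y = x \<bullet> (A *v y)"
  by (metis assms dot_lmul_matrix vector_transpose_matrix)

lemma mat_vector_mult: "mat x *v v = x *\<^sub>R (v :: real^'n)"
proof -
  have "mat x *v v = (x *\<^sub>R mat 1) *v v"
    by (rule arg_cong[where f = "\<lambda>A. A *v v"]) (simp add: vec_eq_iff mat_def)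
  then show ?thesis by (metis matrix_vector_mul_lid scaleR_matrix_vector_assoc)
qed

lemma poly_det:
  fixes A :: "('a::comm_ring_1 poly)^'n^'n"
  shows "poly (det A) x = det (\<chi> i j. poly (A $ i $ j) x)"
  by (simp add: det_def poly_sum poly_prod)

lemma poly_charpoly:
  fixes A :: "real^'n^'n"
  shows "poly (charpoly A) x = det (mat x - A)"
proof -
  have "(\<chi> i j. poly ((mat [:0, 1:] - (\<chi> i j. [:A $ i $ j:])) $ i $ j) x) = mat x - A"
    by (simp add: vec_eq_iff mat_def)
  then show ?thesis
    by (simp add: charpoly_def poly_det)
qed

text \<open>An orthogonal basis of \<open>K\<close> is extended to one of the whole space and
  indexed by \<open>'n\<close>, so that the vectors can be the rows of a square matrix.\<close>

lemma orthogonal_adapted_frame: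
  fixes K :: "(real^'n) set"
  assumes "subspace K"
  obtains s :: "'n \<Rightarrow> real^'n" and J :: "'n set" where
    "\<And>i j. i \<noteq> j \<Longrightarrow> s i \<bullet> s j = 0" "\<And>i. s i \<noteq> 0" "span (s ` J) = K" "card J = dim K"
proof -
  obtain B where B: "0 \<notin> B" "B \<subseteq> K" "pairwise orthogonal B" "independent B"
                  "card B = dim K" "span B = K"
    using orthogonal_basis_subspace[OF assms] by blast
  obtain U where U: "U \<inter> insert 0 B = {}" "pairwise orthogonal (B \<union> U)"
                  "span (B \<union> U) = span (B \<union> UNIV)"
    using orthogonal_extension_strong[OF B(3)] by metis
  let ?F = "B \<union> U"
  have "0 \<notin> ?F" using B U by auto
  then have ind: "independent ?F" using pairwise_orthogonal_independent U(2) by blast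
  have sp: "span ?F = UNIV" by (simp add: U(3))
  have cF: "card ?F = CARD('n)"
    using dim_eq_card[OF _ ind] sp by (metis DIM_cart DIM_real dim_UNIV mult.right_neutral span_UNIV)
  have "finite ?F" using ind independent_imp_finite by blast
  then obtain s :: "'n \<Rightarrow> real^'n" where s: "bij_betw s UNIV ?F"
    using finite_same_card_bij[of "UNIV :: 'n set" ?F] cF by auto
  have inj: "inj s" and ran: "range s = ?F" using s by (auto simp: bij_betw_def)
  define J where "J = s -` B"
  have J: "s ` J = B" unfolding J_def using ran by (auto simp: image_vimage_eq)
  show thesis
  proof (rule that)
    show "s i \<bullet> s j = 0" if "i \<noteq> j" for i j
    proof -
      have "s i \<noteq> s j" "s i \<in> ?F" "s j \<in> ?F" using that inj ran by (auto dest: injD)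
      then show ?thesis using U(2) by (auto simp: pairwise_def orthogonal_def)
    qed
    show "s i \<noteq> 0" for i using ran \<open>0 \<notin> ?F\<close> by (metis rangeI)
    show "span (s ` J) = K" using J B by simp
    show "card J = dim K" using J B inj by (metis card_image inj_on_subset subset_UNIV)
  qed
qed

lemma orthogonal_family_independent:
  fixes s :: "'n::finite \<Rightarrow> 'a::real_inner"
  assumes "\<And>i j. i \<noteq> j \<Longrightarrow> s i \<bullet> s j = 0" "\<And>i. s i \<noteq> 0" "(\<Sum>i\<in>UNIV. c i *\<^sub>R s i) = 0"
  shows "c i = 0"
proof -
  have "0 = (\<Sum>j\<in>UNIV. c j *\<^sub>R s j) \<bullet> s i" by (simp add: assms)
  also have "\<dots> = (\<Sum>j\<in>UNIV. if j = i then c i * (s i \<bullet> s i) else 0)"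
    unfolding inner_sum_left by (rule sum.cong) (auto simp: assms(1))
  finally show ?thesis using assms(2) by simp
qed

text \<open>In an orthogonal frame adapted to the eigenspace, the rows of \<open>(x - A)\<close> belonging to the
  eigenspace are multiples of \<open>x - \<theta>\<close>; after dividing these factors out, the remaining determinant
  does not vanish at \<open>\<theta>\<close>.\<close>

lemma charpoly_symmetric:
  fixes A :: "real^'n^'n"
  assumes sym: "transpose A = A"
  shows charpoly_nonzero: "charpoly A \<noteq> 0"
    and order_charpoly_symmetric: "order \<theta> (charpoly A) = dim {v. A *v v = \<theta> *\<^sub>R v}"
proof -
  let ?K = "{v. A *v v = \<theta> *\<^sub>R v}"
  have subK: "subspace ?K"
    by (auto simp: subspace_def matrix_vector_right_distrib scaleR_right_distrib
        matrix_vector_mult_scaleR)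
  obtain s :: "'n \<Rightarrow> real^'n" and J :: "'n set" where s: "\<And>i j. i \<noteq> j \<Longrightarrow> s i \<bullet> s j = 0" "\<And>i. s i \<noteq> 0"
    "span (s ` J) = ?K" "card J = dim ?K"
    using orthogonal_adapted_frame[OF subK] by blast
  have eig: "A *v s j = \<theta> *\<^sub>R s j" if "j \<in> J" for j
  proof -
    have "s j \<in> span (s ` J)" using that by (simp add: span_base)
    then show ?thesis unfolding s(3) by simp
  qed
  \<comment> \<open>\<open>C x\<close> is the product of \<open>S\<close> and
    \<open>mat x - A\<close> with the factor x - \<theta> taken out of the rows in \<open>J\<close>;
    \<open>q\<close> is its determinant as a polynomial in x.\<close>
  define q where "q = det (\<chi> i k. if i \<in> J then [:s i $ k:] else [:- (A *v s i) $ k, s i $ k:])"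
  define S where "S = (\<chi> i. s i)"
  define C where "C = (\<lambda>x. (\<chi> i. if i \<in> J then s i else x *\<^sub>R s i - A *v s i))"
  have detC: "poly q x = det (C x)" for x
    unfolding q_def poly_det C_def
    by (rule arg_cong[where f = det]) (auto simp: vec_eq_iff)
  have row: "(S ** (mat x - A)) $ i = x *\<^sub>R s i - A *v s i" for i x
  proof -
    have "(S ** (mat x - A)) $ i = s i v* (mat x - A)"
      by (simp add: S_def vec_eq_iff matrix_matrix_mult_def vector_matrix_mult_def mult.commute)
    also have "\<dots> = transpose (mat x - A) *v s i" by simp
    also have "transpose (mat x - A) = mat x - A"
      using sym by (simp add: transpose_def vec_eq_iff mat_def)
    also have "(mat x - A) *v s i = x *\<^sub>R s i - A *v s i"
      by (simp add: matrix_vector_mult_diff_rdistrib mat_vector_mult)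
    finally show ?thesis .
  qed
  have key: "det S * poly (charpoly A) x = (x - \<theta>) ^ card J * poly q x" for x
  proof -
    let ?c = "\<lambda>i. if i \<in> J then x - \<theta> else 1"
    have "S ** (mat x - A) = (\<chi> i. ?c i *s (C x $ i))"
      by (subst vec_eq_iff) (auto simp: row C_def eig vec_eq_iff left_diff_distrib)
    then have "det (S ** (mat x - A)) = prod ?c UNIV * det (C x)"
      by (simp add: det_rows_mul)
    also have "prod ?c UNIV = (x - \<theta>) ^ card J"
      by (simp add: prod.If_cases)
    finally show ?thesis by (simp add: det_mul poly_charpoly detC)
  qed
  have independent_rows_det: "det B \<noteq> 0"
    if "\<And>c. (\<Sum>i\<in>UNIV. c i *\<^sub>R (B $ i)) = 0 \<Longrightarrow> \<forall>i. c i = 0" for B :: "real^'n^'n"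
  proof -
    have "\<exists>B'. B ** B' = mat 1"
      unfolding matrix_right_invertible_independent_rows row_def vec_nth_inverse
      using that by (simp add: scalar_mult_eq_scaleR)
    then show ?thesis by (metis invertible_det_nz invertible_right_inverse)
  qed
  have detS: "det S \<noteq> 0"
    by (rule independent_rows_det)
      (use orthogonal_family_independent[of s] s in \<open>auto simp: S_def\<close>)
  \<comment> \<open>A vanishing combination of rows splits into \<open>k\<close> in the eigenspace
    plus (\<theta> - A) u, where \<open>u\<close> is orthogonal to the eigenspace. By symmetry
    (\<theta> - A) u is orthogonal to \<open>k\<close>, so \<open>k\<close> = 0; then
    \<open>u\<close> lies in the eigenspace and is orthogonal to itself.\<close>
  have "det (C \<theta>) \<noteq> 0"
  proof (rule independent_rows_det)
    fix c assume c: "(\<Sum>i\<in>UNIV. c i *\<^sub>R (C \<theta> $ i)) = 0"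
    define k where "k = (\<Sum>i\<in>J. c i *\<^sub>R s i)"
    define u where "u = (\<Sum>i\<in>-J. c i *\<^sub>R s i)"
    have "(\<Sum>i\<in>UNIV. c i *\<^sub>R (C \<theta> $ i)) = (\<Sum>i\<in>J. c i *\<^sub>R (C \<theta> $ i)) + (\<Sum>i\<in>-J. c i *\<^sub>R (C \<theta> $ i))"
      by (subst sum.union_disjoint[symmetric]) auto
    also have "(\<Sum>i\<in>J. c i *\<^sub>R (C \<theta> $ i)) = k" by (simp add: k_def C_def)
    also have "(\<Sum>i\<in>-J. c i *\<^sub>R (C \<theta> $ i)) = \<theta> *\<^sub>R u - A *v u"
      by (simp add: u_def C_def linear_sum[OF matrix_vector_mul_linear] scaleR_right_diff_distrib sum_subtractf
          scaleR_sum_right matrix_vector_mult_scaleR mult.commute)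
    finally have 0: "k + (\<theta> *\<^sub>R u - A *v u) = 0" using c by simp
    have kK: "k \<in> ?K" unfolding k_def
      using subK eig by (intro subspace_sum) (auto simp: matrix_vector_mult_scaleR)
    have "(\<theta> *\<^sub>R u - A *v u) \<bullet> k = 0"
      using symmetric_inner[OF sym, of u k] kK by (simp add: inner_diff_left)
    with 0 have "k \<bullet> k = 0" by (metis add_0 add.right_neutral inner_add_left inner_zero_left)
    then have k0: "k = 0" by simp
    have "u \<in> ?K" using 0 k0 by simp
    then have "u \<in> span (s ` J)" using s(3) by simp
    moreover have "orthogonal u y" if "y \<in> s ` J" for y
    proof -
      from that obtain j where j: "j \<in> J" "y = s j" by blast
      then have "s i \<bullet> s j = 0" if "i \<in> -J" for i using that by (intro s(1)) auto
      then show ?thesis unfolding u_def orthogonal_def inner_sum_left j by simp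
    qed
    ultimately have "orthogonal u u" by (rule orthogonal_to_span)
    then have u0: "u = 0" by (simp add: orthogonal_def)
    have "(\<Sum>i\<in>UNIV. c i *\<^sub>R s i) = k + u"
      unfolding k_def u_def by (subst sum.union_disjoint[symmetric]) auto
    then have sum0: "(\<Sum>i\<in>UNIV. c i *\<^sub>R s i) = 0" by (simp add: k0 u0)
    show "\<forall>i. c i = 0"
    proof
      show "c i = 0" for i
        by (rule orthogonal_family_independent[of s c]) (simp_all add: s(1,2) sum0)
    qed
  qed
  then have q\<theta>: "poly q \<theta> \<noteq> 0" by (simp add: detC)
  have eq: "smult (det S) (charpoly A) = [:-\<theta>, 1:] ^ card J * q"
    by (subst poly_eq_poly_eq_iff[symmetric]) (auto simp: key poly_power)
  have "q \<noteq> 0" using q\<theta> by auto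
  then have nz: "[:-\<theta>, 1:] ^ card J * q \<noteq> 0" by simp
  then show "charpoly A \<noteq> 0" using eq by auto
  have "order \<theta> (charpoly A) = order \<theta> ([:-\<theta>, 1:] ^ card J * q)"
    using eq detS by (metis order_smult)
  also have "\<dots> = card J"
    using order_mult[OF nz] order_0I[OF q\<theta>] by (simp add: order_power_n_n)
  finally show "order \<theta> (charpoly A) = dim ?K" by (simp add: s(4))
qed

text \<open>The entries in columns b, c, d form a triangular 3 by 3 minor, so rows a, b, c are
  independent. With nullity at least n - 3 they already span the row space.\<close>

lemma row_dependency:
  fixes M :: "real^'n^'n"
  assumes dim: "dim {v. M *v v = 0} \<ge> CARD('n) - 3"
    and tri: "M $ a $ b \<noteq> 0" "M $ a $ c = 0" "M $ a $ d = 0" "M $ b $ c \<noteq> 0" "M $ b $ d = 0"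
      "M $ c $ d \<noteq> 0"
  obtains \<alpha> \<beta> \<gamma> where "M $ u = \<alpha> *\<^sub>R M $ a + \<beta> *\<^sub>R M $ b + \<gamma> *\<^sub>R M $ c"
proof -
  let ?R = "{M $ a, M $ b, M $ c}"
  let ?K = "{v. M *v v = 0}"
  have "M $ c \<noteq> 0" using tri(6) by auto
  moreover have "M $ b \<notin> span {M $ c}" "M $ b \<noteq> M $ c"
  proof -
    show "M $ b \<notin> span {M $ c}"
    proof
      assume "M $ b \<in> span {M $ c}"
      then obtain k where "M $ b - k *\<^sub>R M $ c = 0"
        unfolding span_breakdown_eq span_empty by blast
      from arg_cong[OF this, of "\<lambda>v. v $ i" for i]
      have k: "M $ b $ i = k * M $ c $ i" for i by simp
      from k[of d] tri have "k = 0" by simp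
      with k[of c] tri show False by simp
    qed
    show "M $ b \<noteq> M $ c" using tri by auto
  qed
  moreover have "M $ a \<notin> span {M $ b, M $ c}" "M $ a \<noteq> M $ b" "M $ a \<noteq> M $ c"
  proof -
    show "M $ a \<notin> span {M $ b, M $ c}"
    proof
      assume "M $ a \<in> span {M $ b, M $ c}"
      then obtain k l where "M $ a - k *\<^sub>R M $ b - l *\<^sub>R M $ c = 0"
        unfolding span_breakdown_eq span_empty by blast
      from arg_cong[OF this, of "\<lambda>v. v $ i" for i]
      have kl: "M $ a $ i - k * M $ b $ i - l * M $ c $ i = 0" for i by simp
      from kl[of d] tri have "l = 0" by simp
      with kl[of c] tri have "k = 0" by simp
      with kl[of b] tri \<open>l = 0\<close> show False by simp
    qed
    show "M $ a \<noteq> M $ b" "M $ a \<noteq> M $ c" using tri by auto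
  qed
  ultimately have ind: "independent ?R" and card: "card ?R = 3"
    by (auto simp: independent_insert)
  have "dim (span ?R) = 3" using dim_eq_card_independent[OF ind] card by simp
  then have W: "dim {y. \<forall>x\<in>span ?R. orthogonal x y} = CARD('n) - 3"
    using dim_subspace_orthogonal_to_vectors[of "span ?R" "UNIV :: (real^'n) set"]
    by simp
  \<comment> \<open>The kernel is orthogonal to the three rows, and the orthogonal complement of
    their span has dimension exactly n - 3.\<close>
  have "?K = (span ?R)\<^sup>\<bottom>"
  proof (rule subspace_dim_equal)
    show "subspace ?K"
      by (auto simp: subspace_def matrix_vector_right_distrib matrix_vector_mult_scaleR)
    show "subspace ((span ?R)\<^sup>\<bottom>)" by (rule subspace_orthogonal_comp)
    show "dim ((span ?R)\<^sup>\<bottom>) \<le> dim ?K" using W dim by (simp add: orthogonal_comp_def)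
    show "?K \<subseteq> (span ?R)\<^sup>\<bottom>"
    proof
      fix v assume "v \<in> ?K"
      then have "M $ i \<bullet> v = 0" for i
        by (simp add: flip: matrix_vector_mul_component)
      then have "orthogonal v x" if "x \<in> ?R" for x
        using that by (auto simp: orthogonal_def inner_commute)
      then have "orthogonal v x" if "x \<in> span ?R" for x
        using orthogonal_to_span[OF that] by blast
      then show "v \<in> (span ?R)\<^sup>\<bottom>" by (simp add: orthogonal_comp_def orthogonal_commute)
    qed
  qed
  then have "?K\<^sup>\<bottom> = span ?R" by (simp add: orthogonal_comp_self)
  moreover have "M $ u \<in> ?K\<^sup>\<bottom>"
    by (auto simp: orthogonal_comp_def orthogonal_def matrix_vector_mul_component vec_eq_iff inner_commute)
  ultimately have "M $ u \<in> span ?R" by simp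
  then obtain \<alpha> \<beta> \<gamma> where "M $ u - \<alpha> *\<^sub>R M $ a - \<beta> *\<^sub>R M $ b - \<gamma> *\<^sub>R M $ c = 0"
    unfolding span_breakdown_eq span_empty by blast
  then have "M $ u = \<alpha> *\<^sub>R M $ a + \<beta> *\<^sub>R M $ b + \<gamma> *\<^sub>R M $ c"
    by (simp add: algebra_simps)
  then show thesis by (rule that)
qed

subsection \<open>Graphs in which the rank is three\<close>

definition induced_P4 :: "('v \<Rightarrow> 'v \<Rightarrow> bool) \<Rightarrow> 'v \<Rightarrow> 'v \<Rightarrow> 'v \<Rightarrow> 'v \<Rightarrow> bool" where
  "induced_P4 E a b c d \<longleftrightarrow>
     distinct [a, b, c, d] \<and> E a b \<and> E b c \<and> E c d \<and> \<not> E a c \<and> \<not> E a d \<and> \<not> E b d"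

text \<open>For irreflexive \<open>E\<close> this is A - l D; its entries avoid the square roots of
  the normalized Laplacian.\<close>

definition shifted_adjacency :: "('v::finite \<Rightarrow> 'v \<Rightarrow> bool) \<Rightarrow> real \<Rightarrow> 'v \<Rightarrow> 'v \<Rightarrow> real" where
  "shifted_adjacency E l u v = (if u = v then - (l * degree_of E u) else of_bool (E u v))"

text \<open>The Dirichlet energy, the sum of (f u - f v)^2 over adjacent pairs, expands to 0 for a
  harmonic function. Hence f agrees across every edge, and connectivity does the rest.\<close>

lemma harmonic_constant:
  fixes f :: "'v::finite \<Rightarrow> real"
  assumes "symp E" and "connected_graph E"
    and harm: "\<And>u. (\<Sum>v | E u v. f v) = degree_of E u * f u"
  shows "f u = f v"
proof -
  let ?e = "\<lambda>u v. of_bool (E u v) :: real"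
  have symE: "?e u v = ?e v u" for u v using assms(1) by (auto simp: symp_def)
  have S: "(\<Sum>v\<in>UNIV. ?e u v * g v) = (\<Sum>v | E u v. g v)" for u and g :: "'v \<Rightarrow> real"
    by (rule sum.mono_neutral_cong_right) auto
  have 1: "(\<Sum>v\<in>UNIV. ?e u v * (f u)\<^sup>2) = degree_of E u * (f u)\<^sup>2" for u
    by (simp add: S degree_of_def)
  have 2: "(\<Sum>v\<in>UNIV. ?e u v * (f u * f v)) = degree_of E u * (f u)\<^sup>2" for u
    by (simp add: S harm flip: sum_distrib_left) (simp add: power2_eq_square)
  have "(\<Sum>u\<in>UNIV. \<Sum>v\<in>UNIV. ?e u v * (f u - f v)\<^sup>2) =
     (\<Sum>u\<in>UNIV. \<Sum>v\<in>UNIV. ?e u v * (f u)\<^sup>2) - 2 * (\<Sum>u\<in>UNIV. \<Sum>v\<in>UNIV. ?e u v * (f u * f v))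
      + (\<Sum>u\<in>UNIV. \<Sum>v\<in>UNIV. ?e u v * (f v)\<^sup>2)"
    by (simp add: power2_diff algebra_simps sum.distrib sum_subtractf sum_distrib_left)
  also have "(\<Sum>u\<in>UNIV. \<Sum>v\<in>UNIV. ?e u v * (f v)\<^sup>2) = (\<Sum>u\<in>UNIV. \<Sum>v\<in>UNIV. ?e u v * (f u)\<^sup>2)"
    by (subst sum.swap) (simp only: symE)
  finally have "(\<Sum>u\<in>UNIV. \<Sum>v\<in>UNIV. ?e u v * (f u - f v)\<^sup>2) = 0"
    by (simp add: 1 2)
  then have "\<forall>u v. ?e u v * (f u - f v)\<^sup>2 = 0"
    by (simp add: sum_nonneg_eq_0_iff sum_nonneg)
  then have step: "E u v \<Longrightarrow> f u = f v" for u v by (auto simp: of_bool_def split: if_splits)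
  have "E\<^sup>*\<^sup>* u v" using assms(2) by (simp add: connected_graph_def)
  then show ?thesis by (induction rule: rtranclp_induct) (auto dest: step)
qed

text \<open>The four variables are \<open>l\<close> times the degrees along an induced \<open>P4\<close>; \<open>p\<close>, \<open>q\<close>, \<open>r\<close> are the
  coefficients expressing the last row of \<open>A - l D\<close> through the first three. The right-hand sides
  \<open>w\<^sub>d = p w\<^sub>a + q w\<^sub>b + r w\<^sub>c\<close> correspond to the possible adjacencies of an outside vertex \<open>w\<close>.\<close>

locale P4_weights =
  fixes x1 x2 x3 x4 p q r :: real
  assumes nz: "x1 \<noteq> 0" "x4 \<noteq> 0" and ne: "x2 \<noteq> -1" "x3 \<noteq> -1"
    and p: "p = x2 + x4 - x2 * x3 * x4" and q: "q = 1 - x3 * x4" and r: "r = - x4"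
    and sum: "(1 - x3 * x4) * (1 + x2) = x4 * (1 + x3)" and qp: "q = p * x1"
begin

text \<open>Here p = x4 + x2 q, and \<open>sum\<close> rewrites x2 q; the resulting linear relation
  between p, q and x4 drives all cases below.\<close>

lemma p': "p = 2 * x4 + 1 - 2 * q"
  using sum unfolding p q by (simp add: algebra_simps)

text \<open>The names record which path vertices w misses. Here w_d = 1 with w_a = 0 and w_b = w_c =
  1 would force x4 (1 + x3) = 0; \<open>misses_d\<close> fails in the same way.\<close>

lemma misses_a: "q + r \<noteq> 1"
proof
  assume "q + r = 1"
  then have "x4 * (1 + x3) = 0" unfolding q r by (simp add: algebra_simps)
  then show False using nz ne by auto
qed

lemma misses_d: "p + q + r \<noteq> 0"
proof
  assume "p + q + r = 0"
  then have "x4 * (1 + x3) = 0" using p' unfolding q r by (simp add: algebra_simps)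
  then show False using nz ne by auto
qed

text \<open>The two alternatives are attachment to the whole path and to its two ends only. By
  \<open>p'\<close> either one says q = x4, whence p = 1.\<close>

lemma balanced:
  assumes "p + q + r = 1 \<or> p = 1"
  shows "x1 = x4" "x2 = x3" "x1 * (1 + x2) = 1"
proof -
  have k: "q = x4" using assms p' r by auto
  then have "p = 1" using p' by simp
  then show x14: "x1 = x4" using qp k by simp
  have "x4 * (1 + x2) = x4 * (1 + x3)" using sum k q by simp
  then show "x2 = x3" using nz by simp
  then show "x1 * (1 + x2) = 1" using k q x14 by (simp add: algebra_simps)
qed

text \<open>By \<open>p'\<close> the condition becomes x4 = 2 q, and q can then be cancelled from
  \<open>sum\<close>.\<close>

lemma misses_b:
  assumes "p + r = 1"
  shows "x2 = 1 + 2 * x3" "x4 * (1 + 2 * x3) = 2" "x1 * (3 + 2 * x3) = 1"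
proof -
  have k: "x4 = 2 * q" using assms p' r by simp
  then have qnz: "q \<noteq> 0" using nz by auto
  have "q * (1 + x2) = x4 * (1 + x3)" unfolding q by (rule sum)
  then have "q * (1 + x2) = q * (2 * (1 + x3))" by (simp add: k)
  then show "x2 = 1 + 2 * x3" using qnz by simp
  have "q = 1 - x3 * (2 * q)" unfolding k[symmetric] by (rule q)
  then have q1: "q * (1 + 2 * x3) = 1" by (simp add: algebra_simps)
  then show "x4 * (1 + 2 * x3) = 2" using k by simp
  have "p = 1 + 2 * q" using p' by (simp add: k)
  then have "q = (1 + 2 * q) * x1" using qp by simp
  then have "q * (1 + 2 * x3) = (1 + 2 * x3) * x1 + 2 * (q * (1 + 2 * x3)) * x1"
    by algebra
  then show "x1 * (3 + 2 * x3) = 1" unfolding q1 by (simp add: algebra_simps)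
qed

lemma misses_ab:
  assumes "r = 1"
  shows "x4 = -1" "x2 = -2"
proof -
  show x4: "x4 = -1" using assms r by simp
  have "(1 + x3) * (x2 + 2) = 0" using sum x4 by (simp add: algebra_simps)
  then show "x2 = -2" using ne by auto
qed

lemma misses_cd:
  assumes "p + q = 0"
  shows "x1 = -1" "x3 = -2"
proof -
  have "q \<noteq> 0" using sum nz ne q by auto
  moreover have "q * (1 + x1) = 0" using assms qp by algebra
  ultimately show "x1 = -1" by simp
  have "q = 2 * x4 + 1" using assms p' by simp
  then have "x4 * (x3 + 2) = 0" using q by (simp add: algebra_simps)
  then show "x3 = -2" using nz by simp
qed

end

text \<open>Irrationality of sqrt 2: for nonzero n the exponent of 2 would be even on the left and
  odd on the right.\<close>

lemma square_eq_double_square: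
  fixes m n :: nat
  assumes "m\<^sup>2 = 2 * n\<^sup>2" shows "n = 0"
proof (rule ccontr)
  assume n: "n \<noteq> 0"
  then have "m \<noteq> 0" using assms by (intro notI) simp
  then have "multiplicity 2 (m\<^sup>2) = 2 * multiplicity 2 m"
    by (simp add: prime_elem_multiplicity_power_distrib)
  moreover have "multiplicity 2 (2 * n\<^sup>2) = Suc (2 * multiplicity 2 n)"
    using n by (simp add: prime_elem_multiplicity_mult_distrib prime_elem_multiplicity_power_distrib)
  ultimately have "2 * multiplicity 2 m = Suc (2 * multiplicity 2 n)" using assms by simp
  then show False by presburger
qed

text \<open>\<open>no_independent_triple\<close> and \<open>common_neighbour\<close> express
  independence number and diameter at most 2; \<open>rows\<close> is what remains of the
  multiplicity hypothesis.\<close>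

locale shifted_rank_three =
  fixes E :: "'v::finite \<Rightarrow> 'v \<Rightarrow> bool" and l :: real
  assumes sym: "E u v \<Longrightarrow> E v u" and irrefl: "\<not> E u u" and connected: "connected_graph E"
    and order: "CARD('v) \<ge> 5"
    and no_independent_triple: "u \<noteq> v \<Longrightarrow> v \<noteq> w \<Longrightarrow> u \<noteq> w \<Longrightarrow> E u v \<or> E v w \<or> E u w"
    and common_neighbour: "u \<noteq> v \<Longrightarrow> \<not> E u v \<Longrightarrow> \<exists>w. E u w \<and> E w v"
    and rows: "induced_P4 E a b c d \<Longrightarrow> \<exists>\<alpha> \<beta> \<gamma>. \<forall>v. shifted_adjacency E l u v =
      \<alpha> * shifted_adjacency E l a v + \<beta> * shifted_adjacency E l b v + \<gamma> * shifted_adjacency E l c v"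
begin

abbreviation "deg \<equiv> degree_of E"
abbreviation "m \<equiv> shifted_adjacency E l"
abbreviation x where "x u \<equiv> l * real (deg u)"

lemma adj_sym: "E u v \<longleftrightarrow> E v u" using sym by blast

lemma m_sym: "m u v = m v u"
  by (auto simp: shifted_adjacency_def adj_sym)

lemma m_diag: "m u u = - x u"
  by (simp add: shifted_adjacency_def)

lemma m_off: "u \<noteq> v \<Longrightarrow> m u v = of_bool (E u v)"
  by (simp add: shifted_adjacency_def)

section \<open>Degree bounds for nonadjacent vertices\<close>

lemma deg_pos:
  assumes "E u v" shows "deg u > 0"
  using assms by (auto simp: degree_of_def card_gt_0_iff)

lemma deg_le:
  assumes "u \<noteq> v" "\<not> E u v"
  shows "deg u \<le> CARD('v) - 2"
proof -
  have "deg u \<le> card (UNIV - {u, v})"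
    unfolding degree_of_def using assms irrefl by (intro card_mono) auto
  then show ?thesis using assms(1) by (simp add: card_Diff_subset)
qed

text \<open>Each of the n - 2 other vertices is adjacent to u or v, as otherwise three vertices
  would be independent; a common neighbour is counted twice.\<close>

lemma deg_sum:
  assumes "u \<noteq> v" "\<not> E u v"
  shows "deg u + deg v \<ge> CARD('v) - 1"
proof -
  let ?N = "\<lambda>u. {w. E u w}"
  obtain w where "E u w" "E v w" using common_neighbour[OF assms] adj_sym by blast
  then have "?N u \<inter> ?N v \<noteq> {}" by blast
  then have 1: "card (?N u \<inter> ?N v) \<ge> 1" by (simp add: Suc_le_eq card_gt_0_iff)
  have "UNIV - {u, v} \<subseteq> ?N u \<union> ?N v"
  proof
    fix w assume "w \<in> UNIV - {u, v}"
    then show "w \<in> ?N u \<union> ?N v"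
      using no_independent_triple[of u w v] assms adj_sym[of v w] by auto
  qed
  then have "card (UNIV - {u, v}) \<le> card (?N u \<union> ?N v)" by (intro card_mono) auto
  then have "CARD('v) - 2 \<le> card (?N u \<union> ?N v)" using assms(1) by (simp add: card_Diff_subset)
  moreover have "deg u + deg v = card (?N u \<union> ?N v) + card (?N u \<inter> ?N v)"
    unfolding degree_of_def by (rule card_Un_Int) auto
  ultimately show ?thesis using 1 by simp
qed

section \<open>Row relations along an induced path\<close>

lemma P4_rev: "induced_P4 E a b c d \<Longrightarrow> induced_P4 E d c b a"
  unfolding induced_P4_def by (auto simp: adj_sym)

lemma P4_m:
  assumes "induced_P4 E a b c d"
  shows "m a b = 1" "m b a = 1" "m b c = 1" "m c b = 1" "m c d = 1" "m d c = 1"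
    "m a c = 0" "m c a = 0" "m a d = 0" "m d a = 0" "m b d = 0" "m d b = 0"
  using assms unfolding induced_P4_def by (auto simp: m_off adj_sym)

text \<open>The columns d, c, b of the path determine the three coefficients one after another,
  because those columns of rows a, b, c are triangular.\<close>

lemma m_formula:
  assumes P: "induced_P4 E a b c d"
  shows "m u v = m u b * m a v + m u c * (x b * m a v + m b v)
    + m u d * ((x b * x c - 1) * m a v + x c * m b v + m c v)"
proof -
  obtain \<alpha> \<beta> \<gamma> where row: "\<And>v. m u v = \<alpha> * m a v + \<beta> * m b v + \<gamma> * m c v"
    using rows[OF P, of u] by blast
  have \<gamma>: "\<gamma> = m u d" using row[of d] by (simp add: P4_m[OF P])
  have \<beta>: "\<beta> = m u c + x c * m u d" using row[of c] \<gamma> by (simp add: P4_m[OF P] m_diag)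
  have \<alpha>: "\<alpha> = m u b + x b * (m u c + x c * m u d) - m u d"
    using row[of b] \<gamma> \<beta> by (simp add: P4_m[OF P] m_diag)
  show ?thesis using row[of v] unfolding \<alpha> \<beta> \<gamma> by (simp add: algebra_simps)
qed

text \<open>At l = 0 the entry (d, a) of \<open>m_formula\<close> would read 0 = 1.\<close>

lemma l_nonzero:
  assumes P: "induced_P4 E a b c d"
  shows "l \<noteq> 0"
  using m_formula[OF P, of d a] by (auto simp: P4_m[OF P] m_diag)

text \<open>The numbers p and q of \<open>P4_weights\<close>: the coefficients of rows a and b in
  row d. That of row c is - x d.\<close>

definition "coeff_a b c d = x b + x d - x b * x c * x d"
definition "coeff_b c d = 1 - x c * x d"

lemma last_row:
  assumes P: "induced_P4 E a b c d"
  shows "m w d = coeff_a b c d * m w a + coeff_b c d * m w b - x d * m w c"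
  using m_formula[OF P, of d w] unfolding m_sym[of w] coeff_a_def coeff_b_def
  by (simp add: P4_m[OF P] m_diag algebra_simps)

lemma m_row_sum: "(\<Sum>v\<in>UNIV. m u v) = (1 - l) * deg u"
proof -
  have "(\<Sum>v\<in>UNIV. m u v) = (\<Sum>v\<in>UNIV. of_bool (E u v) - (if u = v then x u else 0))"
    by (rule sum.cong) (auto simp: shifted_adjacency_def irrefl)
  also have "\<dots> = (\<Sum>v\<in>UNIV. of_bool (E u v)) - x u" by (simp add: sum_subtractf)
  also have "(\<Sum>v\<in>UNIV. of_bool (E u v)) = real (deg u)"
    by (simp add: degree_of_def)
  finally show ?thesis by (simp add: algebra_simps)
qed

text \<open>For \<open>l = 1\<close> the linear dependency would be a harmonic function supported on four vertices.\<close>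

lemma l_not_one:
  assumes P: "induced_P4 E a b c d"
  shows "l \<noteq> 1"
proof
  assume l: "l = 1"
  have dist: "distinct [a, b, c, d]" using P by (simp add: induced_P4_def)
  \<comment> \<open>The dependency between rows a, b, c, d as a vector, zero off the path. At l = 1
    it lies in the kernel of A - D, so it is harmonic.\<close>
  define f where "f = (\<lambda>v. if v = a then coeff_a b c d else if v = b then coeff_b c d
    else if v = c then - x d else if v = d then -1 else 0)"
  have "(\<Sum>v | E u v. f v) = deg u * f u" for u
  proof -
    have "(\<Sum>v\<in>UNIV. m u v * f v) = (\<Sum>v\<in>{a, b, c, d}. m u v * f v)"
      by (rule sum.mono_neutral_right) (auto simp: f_def)
    also have "\<dots> = coeff_a b c d * m u a + coeff_b c d * m u b - x d * m u c - m u d"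
      using dist by (auto simp: f_def)
    also have "\<dots> = 0" using last_row[OF P, of u] by simp
    finally have "0 = (\<Sum>v\<in>UNIV. m u v * f v)" by simp
    also have "\<dots> = (\<Sum>v\<in>UNIV. (if E u v then f v else 0) - (if u = v then deg u * f u else 0))"
      by (rule sum.cong) (auto simp: shifted_adjacency_def irrefl l)
    also have "\<dots> = (\<Sum>v | E u v. f v) - deg u * f u"
      by (simp add: sum_subtractf sum.If_cases)
    finally show ?thesis by simp
  qed
  then have const: "f u = f v" for u v
    using connected by (intro harmonic_constant[of E]) (auto simp: symp_def sym)
  \<comment> \<open>As n is at least 5, some vertex lies off the path; there f is 0, but f d =
    -1.\<close>
  have "card {a, b, c, d} < CARD('v)" using order dist by simp
  then have "{a, b, c, d} \<noteq> UNIV" by (metis nat_less_le)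
  then obtain e where "e \<notin> {a, b, c, d}" by blast
  then show False using const[of d e] dist by (auto simp: f_def)
qed

text \<open>With x b = -1 the two equations force x c = -1 and x a + x d = x b. Then deg a + deg d =
  deg b, against the lower bound n - 1 for the nonadjacent ends and the upper bound n - 2 for
  b.\<close>

lemma inner_not_minus_one:
  assumes P: "induced_P4 E a b c d"
    and sum: "(1 - x c * x d) * (1 + x b) = x d * (1 + x c)"
    and qp: "coeff_b c d = coeff_a b c d * x a"
    and nz: "x d \<noteq> 0"
  shows "x b \<noteq> -1"
proof
  assume b: "x b = -1"
  then have "x c = -1" using sum nz by auto
  then have "x a + x d = -1" using qp b unfolding coeff_a_def coeff_b_def by simp
  then have "l * (real (deg a) + real (deg d)) = l * real (deg b)" using b by (simp add: distrib_left)
  then have "deg a + deg d = deg b" using l_nonzero[OF P] by (simp flip: of_nat_add)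
  moreover have "deg a + deg d \<ge> CARD('v) - 1" "deg b \<le> CARD('v) - 2"
    using P deg_sum[of a d] deg_le[of b d] unfolding induced_P4_def by auto
  ultimately show False using order by simp
qed

text \<open>Summing \<open>last_row\<close> over all vertices turns entries into row sums (1 - l)
  deg, and 1 - l cancels. The second equation is \<open>last_row\<close> at vertex a.\<close>

lemma P4_sum:
  assumes P: "induced_P4 E a b c d"
  shows "(1 - x c * x d) * (1 + x b) = x d * (1 + x c)"
    and "coeff_b c d = coeff_a b c d * x a"
proof -
  let ?p = "coeff_a b c d" and ?q = "coeff_b c d"
  show qp: "?q = ?p * x a"
    using last_row[OF P, of a] by (simp add: P4_m[OF P] m_diag)
  have "(1 - l) * deg d = (\<Sum>v\<in>UNIV. m v d)" by (simp add: m_row_sum m_sym[of _ d])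
  also have "\<dots> = ?p * (\<Sum>v\<in>UNIV. m v a) + ?q * (\<Sum>v\<in>UNIV. m v b) - x d * (\<Sum>v\<in>UNIV. m v c)"
    by (simp add: last_row[OF P] sum.distrib sum_subtractf sum_distrib_left)
  also have "\<dots> = (1 - l) * (?p * deg a + ?q * deg b - x d * deg c)"
    by (simp add: m_sym[of _ a] m_sym[of _ b] m_sym[of _ c] m_row_sum algebra_simps)
  finally have "real (deg d) = ?p * deg a + ?q * deg b - x d * deg c"
    using l_not_one[OF P] by simp
  then have "x d = ?p * x a + ?q * x b - x d * x c" by algebra
  then show "(1 - x c * x d) * (1 + x b) = x d * (1 + x c)"
    using qp unfolding coeff_b_def by (simp add: algebra_simps)
qed

section \<open>Attachments of an outside vertex to the path\<close>

lemma weights: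
  assumes P: "induced_P4 E a b c d"
  shows "P4_weights (x a) (x b) (x c) (x d) (coeff_a b c d) (coeff_b c d) (- x d)"
proof -
  have "deg a > 0" "deg d > 0"
    using P unfolding induced_P4_def by (auto intro: deg_pos sym)
  then have nz: "x a \<noteq> 0" "x d \<noteq> 0" using l_nonzero[OF P] by auto
  show ?thesis
    \<comment> \<open>The bound for x c is the one for the inner vertex b applied to the reversed
      path.\<close>
    using nz P4_sum[OF P] inner_not_minus_one[OF P] P4_sum[OF P4_rev[OF P]]
      inner_not_minus_one[OF P4_rev[OF P]]
    by unfold_locales (auto simp: coeff_a_def coeff_b_def)
qed

text \<open>The vertex w must meet each nonadjacent pair {a, c}, {a, d}, {b, d}, which leaves eight
  attachments; \<open>misses_a\<close> and \<open>misses_d\<close> exclude two of them.\<close>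

lemma attachment_cases:
  assumes P: "induced_P4 E a b c d" and w: "w \<notin> {a, b, c, d}"
  obtains (full) "E w a" "E w b" "E w c" "E w d"
    | (ends) "E w a" "\<not> E w b" "\<not> E w c" "E w d"
    | (miss_b) "E w a" "\<not> E w b" "E w c" "E w d"
    | (miss_c) "E w a" "E w b" "\<not> E w c" "E w d"
    | (miss_ab) "\<not> E w a" "\<not> E w b" "E w c" "E w d"
    | (miss_cd) "E w a" "E w b" "\<not> E w c" "\<not> E w d"
proof -
  interpret P4_weights "x a" "x b" "x c" "x d" "coeff_a b c d" "coeff_b c d" "- x d"
    by (rule weights[OF P])
  have row: "of_bool (E w d) = coeff_a b c d * of_bool (E w a) + coeff_b c d * of_bool (E w b)
      + (- x d) * of_bool (E w c)"
    using last_row[OF P, of w] w by (simp add: m_off)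
  have "E w a \<or> E w c" "E w a \<or> E w d" "E w b \<or> E w d"
    using no_independent_triple[of w a c] no_independent_triple[of w a d]
      no_independent_triple[of w b d] P w unfolding induced_P4_def by auto
  moreover have "\<not> (\<not> E w a \<and> E w b \<and> E w c \<and> E w d)" using row misses_a by auto
  moreover have "\<not> (E w a \<and> E w b \<and> E w c \<and> \<not> E w d)"
  proof
    assume "E w a \<and> E w b \<and> E w c \<and> \<not> E w d"
    then have "coeff_a b c d + coeff_b c d + (- x d) = 0" using row by simp
    then show False using misses_d by blast
  qed
  ultimately show thesis using that by blast
qed

text \<open>One such w makes the weights symmetric along the path, which forces every outside vertex
  to be joined to the whole path (\<open>?T\<close>) or to the two ends only (\<open>?S\<close>).
  There is at most one of each kind, so three small graphs remain, and the two containing a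
  \<open>?T\<close> vertex have no consistent l.\<close>

lemma balanced_case:
  assumes P: "induced_P4 E a b c d" and w: "w \<notin> {a, b, c, d}" "E w a" "E w d"
    and bc: "E w b \<longleftrightarrow> E w c"
  shows "isomorphic_to_cycle 5 E"
proof -
  interpret P4_weights "x a" "x b" "x c" "x d" "coeff_a b c d" "coeff_b c d" "- x d"
    by (rule weights[OF P])
  have row: "of_bool (E v d) = coeff_a b c d * of_bool (E v a) + coeff_b c d * of_bool (E v b)
      + (- x d) * of_bool (E v c)" if "v \<notin> {a, b, c, d}" for v
    using last_row[OF P, of v] that by (simp add: m_off)
  have dist: "distinct [a, b, c, d]" and E: "E a b" "E b c" "E c d" "E b a" "E c b" "E d c"
    and nE: "\<not> E a c" "\<not> E a d" "\<not> E b d" "\<not> E c a" "\<not> E d a" "\<not> E d b"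
    using P sym unfolding induced_P4_def by blast+
  have "coeff_a b c d + coeff_b c d + (- x d) = 1 \<or> coeff_a b c d = 1"
    using row[OF w(1)] w(2,3) bc by (cases "E w b") auto
  note bal = balanced[OF this]
  have lnz: "l \<noteq> 0" by (rule l_nonzero[OF P])
  have da: "deg a = deg d" and db: "deg b = deg c" using bal lnz by auto
  define y where "y = x b"
  have y: "x b = y" "x c = y" using bal by (auto simp: y_def)
  have xay: "x a * (1 + y) = 1" using bal(3) y by simp
  have yne: "y \<noteq> -1" using ne y by simp
  have ynz: "y \<noteq> 0" using lnz E(2) deg_pos by (auto simp: y_def)
  have bsum: "deg b < deg a + deg d"
    using deg_sum[of a d] deg_le[of b d] dist nE order by auto
  \<comment> \<open>Missing exactly one inner vertex would give y = 1 + 2 y, so y = -1. Missing two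
    consecutive vertices at an end would make an inner degree twice an end degree, against
    \<open>bsum\<close>.\<close>
  have other: "E v a \<and> E v d \<and> (E v b \<longleftrightarrow> E v c)" if v: "v \<notin> {a, b, c, d}" for v
    using P v
  proof (cases rule: attachment_cases)
    case miss_b
    then have "x b = 1 + 2 * x c" using row[OF v] by (intro misses_b) auto
    then show ?thesis using y yne by simp
  next
    case miss_c
    interpret rev: P4_weights "x d" "x c" "x b" "x a" "coeff_a c b a" "coeff_b b a" "- x a"
      by (rule weights[OF P4_rev[OF P]])
    have "m v a = coeff_a c b a * m v d + coeff_b b a * m v c - x a * m v b"
      by (rule last_row[OF P4_rev[OF P]])
    then have "x c = 1 + 2 * x b" using miss_c v by (intro rev.misses_b) (auto simp: m_off)
    then show ?thesis using y yne by simp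
  next
    case miss_ab
    then have "- x d = 1" using row[OF v] by simp
    then have "x d = -1" "x b = -2" using misses_ab by auto
    then have "l * real (deg b) = l * real (2 * deg d)" by simp
    then have "deg b = 2 * deg d" using lnz by (metis mult_left_cancel of_nat_eq_iff)
    then show ?thesis using bsum da by simp
  next
    case miss_cd
    then have "coeff_a b c d + coeff_b c d = 0" using row[OF v] by simp
    then have "x a = -1" "x c = -2" using misses_cd by auto
    then have "l * real (deg c) = l * real (2 * deg a)" by simp
    then have "deg c = 2 * deg a" using lnz by (metis mult_left_cancel of_nat_eq_iff)
    then show ?thesis using bsum da db by simp
  qed auto
  have formula: "m u v = m u b * m a v + m u c * (y * m a v + m b v)
    + m u d * ((y * y - 1) * m a v + y * m b v + m c v)" for u v
    using m_formula[OF P, of u v] y by simp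
  let ?T = "\<lambda>v. v \<notin> {a, b, c, d} \<and> E v a \<and> E v b \<and> E v c \<and> E v d"
  let ?S = "\<lambda>v. v \<notin> {a, b, c, d} \<and> E v a \<and> \<not> E v b \<and> \<not> E v c \<and> E v d"
  have mT: "m t a = 1" "m t b = 1" "m t c = 1" "m t d = 1"
      "m a t = 1" "m b t = 1" "m c t = 1" "m d t = 1" if "?T t" for t
    using that by (auto simp: m_off adj_sym[of a] adj_sym[of b] adj_sym[of c] adj_sym[of d])
  have mS: "m s a = 1" "m s b = 0" "m s c = 0" "m s d = 1"
      "m a s = 1" "m b s = 0" "m c s = 0" "m d s = 1" if "?S s" for s
    using that by (auto simp: m_off adj_sym[of a] adj_sym[of b] adj_sym[of c] adj_sym[of d])
  have TT: "m t t' = (1 + y)\<^sup>2 + 1" if "?T t" "?T t'" for t t'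
    using formula[of t t'] mT[OF that(1)] mT[OF that(2)]
    by (simp add: algebra_simps power2_eq_square)
  have SS: "m s s' = y\<^sup>2 - 1" if "?S s" "?S s'" for s s'
    using formula[of s s'] mS[OF that(1)] mS[OF that(2)]
    by (simp add: algebra_simps power2_eq_square)
  have TS: "m t s = y * (y + 1)" if "?T t" "?S s" for t s
    using formula[of t s] mT[OF that(1)] mS[OF that(2)]
    by (simp add: algebra_simps power2_eq_square)
  \<comment> \<open>The off-diagonal entry (1 + y)^2 + 1 exceeds 1, so it is no adjacency
    value.\<close>
  have T_unique: "t = t'" if "?T t" "?T t'" for t t'
  proof (rule ccontr)
    assume "t \<noteq> t'"
    then have "(1 + y)\<^sup>2 + 1 = of_bool (E t t')" using TT[OF that] by (simp add: m_off)
    moreover have "(1 + y)\<^sup>2 > 0" using yne by auto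
    ultimately show False by (cases "E t t'") auto
  qed
  \<comment> \<open>Two such vertices both miss b, hence are adjacent, so y^2 = 2. The diagonal
    entry then gives x s = -1, and (deg b / deg s)^2 = 2 is impossible.\<close>
  have S_unique: "s = s'" if S: "?S s" "?S s'" for s s'
  proof (rule ccontr)
    assume neq: "s \<noteq> s'"
    have "E s s'" using no_independent_triple[of b s s'] neq S sym by blast
    then have y2: "y\<^sup>2 = 2" using SS[OF S] neq by (simp add: m_off)
    then have "x s = -1" using SS[OF S(1) S(1)] by (simp add: m_diag)
    then have "(real (deg b))\<^sup>2 = 2 * (real (deg s))\<^sup>2"
      using y2 unfolding y_def by algebra
    then have "(deg b)\<^sup>2 = 2 * (deg s)\<^sup>2" by (metis of_nat_eq_iff of_nat_mult of_nat_numeral of_nat_power)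
    moreover have "deg s > 0" using S deg_pos by blast
    ultimately show False using square_eq_double_square[of "deg b" "deg s"] by simp
  qed
  have univ: "v \<in> {a, b, c, d} \<or> ?T v \<or> ?S v" for v using other[of v] by blast
  show ?thesis
  proof (cases "\<exists>t. ?T t")
    case False
    have wS: "?S w" using w bc False by blast
    have U: "UNIV = {a, b, c, d, w}" using univ False S_unique[OF wS] by blast
    have wE: "E w a" "\<not> E w b" "\<not> E w c" "E w d" "E a w" "\<not> E b w" "\<not> E c w" "E d w"
      using wS sym by blast+
    let ?f = "\<lambda>v. if v = a then 0 else if v = b then 1 else if v = c then 2
       else if v = d then 3 else (4::nat)"
    have all: "(\<forall>u. Q u) \<longleftrightarrow> Q a \<and> Q b \<and> Q c \<and> Q d \<and> Q w" for Q
      using U by (metis UNIV_I empty_iff insert_iff)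
    have "bij_betw ?f UNIV {..<5}"
      unfolding bij_betw_def U using dist w(1)
      by (auto simp: inj_on_def lessThan_nat_numeral lessThan_Suc)
    moreover have "\<forall>u v. E u v \<longleftrightarrow> cycle_adj 5 (?f u) (?f v)"
      unfolding all using dist w(1) E nE wE irrefl
      by (auto simp: cycle_adj_def)
    ultimately show ?thesis unfolding isomorphic_to_cycle_def by blast
  next
    case True
    then obtain t where t: "?T t" by blast
    have tE: "E t a" "E t b" "E t c" "E t d" "E a t" "E b t" "E c t" "E d t"
      using t sym by blast+
    have xt: "- x t = (1 + y)\<^sup>2 + 1" using TT[OF t t] by (simp add: m_diag)
    have False
    proof (cases "\<exists>s. ?S s")
      case False
      have U: "UNIV = {a, b, c, d, t}" using univ False T_unique[OF t] by blast
      have N: "{v. E u v} = {v \<in> {a, b, c, d, t}. E u v}" for u using U by blast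
      have "{v. E a v} = {b, t}" "{v. E b v} = {a, c, t}" "{v. E t v} = {a, b, c, d}"
        unfolding N using E nE tE irrefl by blast+
      then have "deg a = 2" "deg b = 3" "deg t = 4"
        using dist t unfolding degree_of_def by auto
      then have "2 * l * (1 + y) = 1" "y = 3 * l" "-4 * l = (1 + y)\<^sup>2 + 1"
        using xay xt y_def by auto
      \<comment> \<open>Two quadratics in l: eliminating l^2 leaves a single candidate, which solves
        neither. The six-vertex case below ends likewise.\<close>
      then have "2 * l * (1 + 3 * l) = 1" "-4 * l = (1 + 3 * l)\<^sup>2 + 1" by simp_all
      then have "6 * l\<^sup>2 = 1 - 2 * l" "9 * l\<^sup>2 = - 10 * l - 2"
        by (simp_all add: algebra_simps power2_eq_square)
      then have "l = - 1 / 2" "6 * l\<^sup>2 = 1 - 2 * l" by auto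
      then show False by (simp add: power2_eq_square)
    next
      case True
      then obtain s where s: "?S s" by blast
      have sE: "E s a" "\<not> E s b" "\<not> E s c" "E s d" "E a s" "\<not> E b s" "\<not> E c s" "E d s"
        using s sym by blast+
      have ts: "t \<noteq> s" using t s by blast
      \<comment> \<open>This entry is 0 or 1, and 0 is excluded by y being neither 0 nor -1.\<close>
      have "of_bool (E t s) = y * (y + 1)" using TS[OF t s] ts by (simp add: m_off)
      then have st: "E t s" "E s t" and yy: "y * (y + 1) = 1"
        using ynz yne sym by (auto simp: of_bool_def split: if_splits)
      have U: "UNIV = {a, b, c, d, t, s}" using univ S_unique[OF s] T_unique[OF t] by blast
      have N: "{v. E u v} = {v \<in> {a, b, c, d, t, s}. E u v}" for u using U by blast
      have "{v. E b v} = {a, c, t}" "{v. E t v} = {a, b, c, d, s}"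
        unfolding N using E nE tE sE st irrefl by auto
      moreover have "distinct [a, b, c, d, t, s]" using dist t s ts by auto
      ultimately have "deg b = 3" "deg t = 5" unfolding degree_of_def by simp_all
      then have "y = 3 * l" "-5 * l = (1 + y)\<^sup>2 + 1"
        using xt y_def by auto
      then have "9 * l\<^sup>2 = 1 - 3 * l" "9 * l\<^sup>2 = - 11 * l - 2"
        using yy by (simp_all add: algebra_simps power2_eq_square)
      then have "l = - 3 / 8" "9 * l\<^sup>2 = 1 - 3 * l" by auto
      then show False by (simp add: power2_eq_square)
    qed
    then show ?thesis ..
  qed
qed

text \<open>The vertex w supplies the equations of \<open>misses_b\<close>. Every outside vertex is
  attached like w, to a and b only (\<open>Y\<close>), or to c and d only (\<open>Z\<close>). Degree
  counts empty \<open>Y\<close> and \<open>Z\<close>; the degrees are then determined enough to make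
  deg c = 5/4.\<close>

lemma unbalanced_case:
  assumes P: "induced_P4 E a b c d" and w: "w \<notin> {a, b, c, d}" "E w a" "E w d"
    and bc: "\<not> E w b" "E w c"
    and unbal: "\<And>v. v \<notin> {a, b, c, d} \<Longrightarrow> E v a \<Longrightarrow> E v d \<Longrightarrow> \<not> (E v b \<longleftrightarrow> E v c)"
  shows False
proof -
  interpret P4_weights "x a" "x b" "x c" "x d" "coeff_a b c d" "coeff_b c d" "- x d"
    by (rule weights[OF P])
  have row: "of_bool (E v d) = coeff_a b c d * of_bool (E v a) + coeff_b c d * of_bool (E v b)
      + (- x d) * of_bool (E v c)" if "v \<notin> {a, b, c, d}" for v
    using last_row[OF P, of v] that by (simp add: m_off)
  have dist: "distinct [a, b, c, d]" and E: "E a b" "E b c" "E c d" "E b a" "E c b" "E d c"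
    and nE: "\<not> E a c" "\<not> E a d" "\<not> E b d" "\<not> E c a" "\<not> E d a" "\<not> E d b"
    using P sym unfolding induced_P4_def by blast+
  have lnz: "l \<noteq> 0" by (rule l_nonzero[OF P])
  have "coeff_a b c d + (- x d) = 1" using row[OF w(1)] w(2,3) bc by simp
  note mb = misses_b[OF this]
  define X where "X = {v. v \<notin> {a, b, c, d} \<and> E c v \<and> E d v}"
  define Y where "Y = {v. v \<notin> {a, b, c, d} \<and> E v a \<and> E v b \<and> \<not> E v c \<and> \<not> E v d}"
  define Z where "Z = {v. v \<notin> {a, b, c, d} \<and> \<not> E v a \<and> \<not> E v b \<and> E v c \<and> E v d}"
  have other: "E v a \<and> \<not> E v b \<and> E v c \<and> E v d \<or> v \<in> Y \<or> v \<in> Z" if v: "v \<notin> {a, b, c, d}" for v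
    using P v
  proof (cases rule: attachment_cases)
    \<comment> \<open>Together with x b = 1 + 2 x c from w, the reversed equation would give x c =
      -1.\<close>
    case miss_c
    interpret rev: P4_weights "x d" "x c" "x b" "x a" "coeff_a c b a" "coeff_b b a" "- x a"
      by (rule weights[OF P4_rev[OF P]])
    have "m v a = coeff_a c b a * m v d + coeff_b b a * m v c - x a * m v b"
      by (rule last_row[OF P4_rev[OF P]])
    then have "x c = 1 + 2 * x b" using miss_c v by (intro rev.misses_b) (auto simp: m_off)
    then show ?thesis using mb(1) ne by simp
  qed (use v unbal[OF v] in \<open>auto simp: Y_def Z_def\<close>)
  \<comment> \<open>Every outside vertex meets both or neither of c and d; on the path c has two
    neighbours and d has one. Hence deg c = deg d + 1.\<close>
  have "(E c v \<longleftrightarrow> v \<in> {b, d} \<union> X) \<and> (E d v \<longleftrightarrow> v \<in> {c} \<union> X)" for v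
  proof -
    consider "v \<in> {a, b, c, d}" | "v \<notin> {a, b, c, d}" "E c v \<longleftrightarrow> E d v"
      using other[of v] adj_sym[of v] unfolding Y_def Z_def by blast
    then show ?thesis
      by cases (use dist E nE irrefl in \<open>auto simp: X_def\<close>)
  qed
  then have "{v. E c v} = {b, d} \<union> X" "{v. E d v} = {c} \<union> X" by blast+
  moreover have "finite X" "b \<notin> X" "c \<notin> X" "d \<notin> X" by (auto simp: X_def)
  ultimately have dd: "deg d = Suc (card X)" and dc: "deg c = Suc (deg d)"
    using dist unfolding degree_of_def by auto
  \<comment> \<open>A vertex of \<open>Y\<close> would give deg c = 3 deg d, so 2 deg d = 1.\<close>
  have Y: "Y = {}"
  proof (rule ccontr)
    assume "Y \<noteq> {}"
    then obtain v where v: "v \<in> Y" by blast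
    then have "coeff_a b c d + coeff_b c d = 0" using row[of v] by (simp add: Y_def)
    then have c: "x c = -2" using misses_cd by auto
    then have "x d * (-3) = 2" using mb(2) by simp
    then have "l * real (deg c) = l * real (3 * deg d)" using c by simp
    then have "deg c = 3 * deg d" using lnz by (metis mult_left_cancel of_nat_eq_iff)
    then show False using dc by presburger
  qed
  have "E b v \<longleftrightarrow> v \<in> {a, c}" for v
  proof -
    consider "v \<in> {a, b, c, d}" | "v \<notin> {a, b, c, d}" "\<not> E b v"
      using other[of v] Y adj_sym[of v] unfolding Z_def by blast
    then show ?thesis by cases (use dist E nE irrefl in auto)
  qed
  then have "{v. E b v} = {a, c}" by blast
  then have db: "deg b = 2" using dist unfolding degree_of_def by simp
  \<comment> \<open>A vertex of \<open>Z\<close> would give l = -1, deg d = 1 and deg c = 2, so x b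
    = -2 would have to equal 1 + 2 x c = -3.\<close>
  have Z: "Z = {}"
  proof (rule ccontr)
    assume "Z \<noteq> {}"
    then obtain v where v: "v \<in> Z" by blast
    then have "- x d = 1" using row[of v] by (simp add: Z_def)
    then have "x d = -1" "x b = -2" using misses_ab by auto
    then have l: "l = -1" "deg d = 1" using db by auto
    then show False using mb(1) dc db by simp
  qed
  have "E a v \<longleftrightarrow> v \<in> {b} \<union> X" for v
  proof -
    consider "v \<in> {a, b, c, d}" | "v \<notin> {a, b, c, d}" "E a v" "E c v" "E d v"
      using other[of v] Y Z adj_sym[of v] by blast
    then show ?thesis by cases (use dist E nE irrefl in \<open>auto simp: X_def\<close>)
  qed
  then have "{v. E a v} = {b} \<union> X" by blast
  then have "deg a = deg d" using \<open>finite X\<close> \<open>b \<notin> X\<close> dd unfolding degree_of_def by simp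
  \<comment> \<open>As x a = x d, this is the difference of the last two equations of
    \<open>misses_b\<close>. From it follow x c and x b, and deg b = 2 fixes l = -2.\<close>
  then have "2 * x a = -1" using mb(2,3) by (simp add: algebra_simps)
  moreover have "(2 * x a) * (3 + 2 * x c) = 2" using mb(3) by simp
  ultimately have "x c = - 5 / 2" by simp
  then have "x b = -4" "x c = - 5 / 2" using mb(1) by auto
  then have "4 * real (deg c) = real 5" using db by simp
  then have "real (4 * deg c) = real 5" by simp
  then have "4 * deg c = 5" by (rule of_nat_eq_iff[THEN iffD1])
  then show False by presburger
qed

text \<open>The ends of the path have a common neighbour w, necessarily outside the path. Unless
  some vertex is balanced, w misses exactly one inner vertex; if this is c, the path is
  reversed.\<close>

lemma induced_P4_imp_C5:
  assumes P: "induced_P4 E a b c d"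
  shows "isomorphic_to_cycle 5 E"
proof (cases "\<exists>v. v \<notin> {a, b, c, d} \<and> E v a \<and> E v d \<and> (E v b \<longleftrightarrow> E v c)")
  case True
  then show ?thesis using balanced_case[OF P] by blast
next
  case False
  obtain w where w: "E a w" "E w d"
    using common_neighbour[of a d] P unfolding induced_P4_def by auto
  then have w': "w \<notin> {a, b, c, d}" "E w a" "E w d"
    using P sym irrefl unfolding induced_P4_def by auto
  have unbal: "\<not> (E v b \<longleftrightarrow> E v c)" if "v \<notin> {a, b, c, d}" "E v a" "E v d" for v
    using False that by blast
  have unbal': "\<not> (E v c \<longleftrightarrow> E v b)" if "v \<notin> {d, c, b, a}" "E v d" "E v a" for v
    using unbal[of v] that by auto
  consider "\<not> E w b" "E w c" | "\<not> E w c" "E w b" using unbal[OF w'] by blast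
  then have False
  proof cases
    case 1
    then show ?thesis by (rule unbalanced_case[OF P w' _ _ unbal])
  next
    case 2
    have "w \<notin> {d, c, b, a}" using w'(1) by auto
    then show ?thesis using w'(3,2) 2 by (rule unbalanced_case[OF P4_rev[OF P] _ _ _ _ _ unbal'])
  qed
  then show ?thesis ..
qed

end

subsection \<open>Independence, diameter and the Laplacian spectrum\<close>

lemma transpose_normalized_laplacian:
  assumes "simple_graph E"
  shows "transpose (normalized_laplacian E) = normalized_laplacian E"
  using assms
  by (auto simp: simple_graph_def symp_def transpose_def normalized_laplacian_def vec_eq_iff mult.commute)

lemma count_nl_spectrum:
  assumes "simple_graph E"
  shows "count (nl_spectrum E) \<theta> = dim {v. normalized_laplacian E *v v = \<theta> *\<^sub>R v}"
  using charpoly_symmetric[OF transpose_normalized_laplacian[OF assms]]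
  by (simp add: nl_spectrum_def)

text \<open>Connectivity provides a walk between u and v, so the \<open>LEAST\<close> in the
  distance is attained.\<close>

lemma graph_dist_le_2_iff:
  assumes "connected_graph E"
  shows "graph_dist E u v \<le> 2 \<longleftrightarrow> u = v \<or> E u v \<or> (\<exists>w. E u w \<and> E w v)"
proof -
  have pow: "(E ^^ 0) = (=)" "(E ^^ 1) = E" "(E ^^ 2) u v \<longleftrightarrow> (\<exists>w. E u w \<and> E w v)"
    by (auto simp: numeral_2_eq_2 relcompp_apply)
  have "\<exists>k. (E ^^ k) u v"
    using assms by (simp add: connected_graph_def rtranclp_is_Sup_relpowp)
  then have at_dist: "(E ^^ graph_dist E u v) u v" unfolding graph_dist_def by (rule LeastI_ex)
  have le: "graph_dist E u v \<le> k" if "(E ^^ k) u v" for k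
    unfolding graph_dist_def using that by (rule Least_le)
  show ?thesis
  proof
    assume "graph_dist E u v \<le> 2"
    then consider "graph_dist E u v = 0" | "graph_dist E u v = 1" | "graph_dist E u v = 2" by linarith
    then show "u = v \<or> E u v \<or> (\<exists>w. E u w \<and> E w v)" using at_dist pow by cases auto
  next
    assume "u = v \<or> E u v \<or> (\<exists>w. E u w \<and> E w v)"
    then show "graph_dist E u v \<le> 2" using le[of 0] le[of 1] le[of 2] pow by auto
  qed
qed

lemma finite_graph_dists: "finite {graph_dist E u v | u v. True}" for E :: "'v::finite \<Rightarrow> 'v \<Rightarrow> bool"
proof -
  have "{graph_dist E u v | u v. True} = (\<lambda>(u, v). graph_dist E u v) ` UNIV" by auto
  then show ?thesis by simp
qed

lemma finite_independent_cards: "finite {card S | S. independent_set E S}"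
  for E :: "'v::finite \<Rightarrow> 'v \<Rightarrow> bool"
  by (rule finite_subset[of _ "card ` UNIV"]) auto

lemma common_neighbour_if_diameter_2:
  fixes E :: "'v::finite \<Rightarrow> 'v \<Rightarrow> bool"
  assumes "connected_graph E" "graph_diameter E = 2" "u \<noteq> v" "\<not> E u v"
  shows "\<exists>w. E u w \<and> E w v"
proof -
  have "graph_dist E u v \<le> 2"
    using Max_ge[OF finite_graph_dists[of E], of "graph_dist E u v"] assms(2)
    unfolding graph_diameter_def by auto
  then show ?thesis using assms graph_dist_le_2_iff by metis
qed

lemma independent_card_le:
  fixes E :: "'v::finite \<Rightarrow> 'v \<Rightarrow> bool"
  assumes "independent_set E S"
  shows "card S \<le> independence_number E"
  unfolding independence_number_def using finite_independent_cards assms by (auto intro: Max_ge)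

text \<open>Entrywise form of the congruence A - (1 - \<theta>) D = - D^(1/2) (L - \<theta> I)
  D^(1/2).\<close>

lemma shifted_adjacency_eq:
  assumes "degree_of E u > 0" "degree_of E v > 0"
  shows "shifted_adjacency E (1 - \<theta>) u v =
    - (sqrt (degree_of E u) * sqrt (degree_of E v) * (normalized_laplacian E - mat \<theta>) $ u $ v)"
  using assms
  by (auto simp: shifted_adjacency_def normalized_laplacian_def mat_def real_sqrt_mult algebra_simps)

lemma degree_pos_connected:
  fixes E :: "'v::finite \<Rightarrow> 'v \<Rightarrow> bool"
  assumes "connected_graph E" "CARD('v) \<ge> 2"
  shows "degree_of E u > 0"
proof -
  have "\<exists>v. u \<noteq> v"
  proof (rule ccontr)
    assume "\<nexists>v. u \<noteq> v"
    then have "(UNIV :: 'v set) = {u}" by auto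
    then have "CARD('v) = card {u}" by (rule arg_cong)
    then show False using assms(2) by simp
  qed
  then obtain v where "u \<noteq> v" by blast
  moreover have "E\<^sup>*\<^sup>* u v" using assms(1) by (simp add: connected_graph_def)
  ultimately obtain w where "E u w" by (metis converse_rtranclpE)
  then show ?thesis by (auto simp: degree_of_def card_gt_0_iff)
qed

text \<open>The multiplicity is the nullity of L - \<theta> I, so \<open>row_dependency\<close>
  applies. The congruence rescales row u by the square root of its degree, hence the quotients of
  square roots in the witnesses.\<close>

lemma laplacian_row_dependency:
  fixes E :: "'v::finite \<Rightarrow> 'v \<Rightarrow> bool"
  assumes simple: "simple_graph E" and conn: "connected_graph E"
    and mult: "count (nl_spectrum E) \<theta> = CARD('v) - 3"
    and P: "induced_P4 E a b c d"
  shows "\<exists>\<alpha> \<beta> \<gamma>. \<forall>v. shifted_adjacency E (1 - \<theta>) u v =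
      \<alpha> * shifted_adjacency E (1 - \<theta>) a v + \<beta> * shifted_adjacency E (1 - \<theta>) b v
      + \<gamma> * shifted_adjacency E (1 - \<theta>) c v"
proof -
  let ?M = "normalized_laplacian E - mat \<theta>"
  let ?d = "\<lambda>u. sqrt (degree_of E u)"
  have "card {a, b} \<le> CARD('v)" by (intro card_mono) auto
  then have pos: "degree_of E u > 0" for u
    using P by (intro degree_pos_connected[OF conn]) (simp add: induced_P4_def)
  have d: "degree_of E u \<noteq> 0" for u using pos[of u] by simp
  have "{v. ?M *v v = 0} = {v. normalized_laplacian E *v v = \<theta> *\<^sub>R v}"
    by (auto simp: matrix_vector_mult_diff_rdistrib mat_vector_mult)
  then have dim: "dim {v. ?M *v v = 0} \<ge> CARD('v) - 3"
    using count_nl_spectrum[OF simple] mult by simp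
  have entries: "?M $ a $ b \<noteq> 0" "?M $ a $ c = 0" "?M $ a $ d = 0" "?M $ b $ c \<noteq> 0"
    "?M $ b $ d = 0" "?M $ c $ d \<noteq> 0"
    using P pos by (auto simp: induced_P4_def normalized_laplacian_def mat_def)
  obtain \<alpha> \<beta> \<gamma> where "?M $ u = \<alpha> *\<^sub>R ?M $ a + \<beta> *\<^sub>R ?M $ b + \<gamma> *\<^sub>R ?M $ c"
    using row_dependency[OF dim entries] by blast
  from arg_cong[OF this, of "\<lambda>w. w $ v" for v]
  have row: "?M $ u $ v = \<alpha> * ?M $ a $ v + \<beta> * ?M $ b $ v + \<gamma> * ?M $ c $ v" for v
    by (simp del: vector_minus_component)
  show ?thesis
    by (rule exI[of _ "\<alpha> * ?d u / ?d a"], rule exI[of _ "\<beta> * ?d u / ?d b"],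
        rule exI[of _ "\<gamma> * ?d u / ?d c"], intro allI)
      (simp add: shifted_adjacency_eq pos row d field_simps del: vector_minus_component)
qed

lemma induced_path_4_imp_induced_P4:
  assumes "has_induced_path 4 E"
  obtains a b c d where "induced_P4 E a b c d"
proof -
  obtain p where p: "inj_on p {..<4}" "\<And>i j. i < 4 \<Longrightarrow> j < 4 \<Longrightarrow> E (p i) (p j) \<longleftrightarrow> path_adj i j"
    using assms unfolding has_induced_path_def by blast
  have "p i \<noteq> p j" if "i < 4" "j < 4" "i \<noteq> j" for i j
    using p(1) that by (auto dest: inj_onD)
  then have "induced_P4 E (p 0) (p 1) (p 2) (p 3)"
    unfolding induced_P4_def by (auto simp: p(2) path_adj_def)
  then show thesis by (rule that)
qed

lemma diameter_2_imp_C5: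
  fixes E :: "'v::finite \<Rightarrow> 'v \<Rightarrow> bool"
  assumes order: "CARD('v) \<ge> 5" and simple: "simple_graph E" and conn: "connected_graph E"
    and mult: "count (nl_spectrum E) \<theta> = CARD('v) - 3"
    and path: "has_induced_path 4 E" and ind: "independence_number E = 2"
    and diam: "graph_diameter E = 2"
  shows "isomorphic_to_cycle 5 E"
proof -
  interpret shifted_rank_three E "1 - \<theta>"
  proof unfold_locales
    show "E v u" if "E u v" for u v using simple that by (auto simp: simple_graph_def symp_def)
    show irr: "\<not> E u u" for u using simple by (auto simp: simple_graph_def irreflp_def)
    show "E u v \<or> E v w \<or> E u w" if "u \<noteq> v" "v \<noteq> w" "u \<noteq> w" for u v w
    proof (rule ccontr)
      assume "\<not> ?thesis"
      then have "independent_set E {u, v, w}"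
        using simple irr by (auto simp: independent_set_def simple_graph_def symp_def)
      from independent_card_le[OF this] show False using that ind by simp
    qed
    show "\<exists>w. E u w \<and> E w v" if "u \<noteq> v" "\<not> E u v" for u v
      using common_neighbour_if_diameter_2[OF conn diam that] .
  qed (use order conn laplacian_row_dependency[OF simple conn mult] in auto)
  obtain a b c d where "induced_P4 E a b c d" using induced_path_4_imp_induced_P4[OF path] .
  then show ?thesis by (rule induced_P4_imp_C5)
qed

section \<open>Invariants and spectrum of the five-cycle\<close>

lemma lt_5_iff: "i < 5 \<longleftrightarrow> i = 0 \<or> i = 1 \<or> i = 2 \<or> i = 3 \<or> i = (4::nat)"
  by auto

text \<open>The inverse labelling \<open>g\<close> names the vertices by 0 to 4, so that
  \<open>all_vertices\<close> turns graph statements into finite checks.\<close>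

locale five_cycle =
  fixes E :: "'v::finite \<Rightarrow> 'v \<Rightarrow> bool" and f :: "'v \<Rightarrow> nat" and g :: "nat \<Rightarrow> 'v"
  assumes simple: "simple_graph E" and conn: "connected_graph E"
    and bij: "bij_betw f UNIV {..<5}" and adj: "E u v \<longleftrightarrow> cycle_adj 5 (f u) (f v)"
  defines "g \<equiv> inv_into UNIV f"
begin

lemma f_lt: "f u < 5"
  using bij by (auto simp: bij_betw_def)

lemma fg [simp]: "i < 5 \<Longrightarrow> f (g i) = i"
  using bij unfolding g_def by (simp add: bij_betw_inv_into_right)

lemma gf [simp]: "g (f u) = u"
  using bij unfolding g_def by (simp add: bij_betw_inv_into_left)

lemma all_vertices: "(\<forall>u. Q u) \<longleftrightarrow> Q (g 0) \<and> Q (g 1) \<and> Q (g 2) \<and> Q (g 3) \<and> Q (g 4)"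
  by (metis gf f_lt lt_5_iff)

lemma adj_g: "i < 5 \<Longrightarrow> j < 5 \<Longrightarrow> E (g i) (g j) \<longleftrightarrow> cycle_adj 5 i j"
  by (simp add: adj)

lemma g_eq: "i < 5 \<Longrightarrow> j < 5 \<Longrightarrow> g i = g j \<longleftrightarrow> i = j"
  by (metis fg)

lemma order_5: "CARD('v) = 5"
  using bij_betw_same_card[OF bij] by simp

lemma neighbours:
  "{v. E (g 0) v} = {g 1, g 4}" "{v. E (g 1) v} = {g 0, g 2}" "{v. E (g 2) v} = {g 1, g 3}"
  "{v. E (g 3) v} = {g 2, g 4}" "{v. E (g 4) v} = {g 0, g 3}"
  by (simp_all add: set_eq_iff all_vertices adj_g g_eq cycle_adj_def)

lemma degree_2: "degree_of E u = 2"
proof -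
  have "\<forall>u. degree_of E u = 2"
    unfolding all_vertices degree_of_def neighbours by (simp add: g_eq)
  then show ?thesis by blast
qed

lemma induced_path: "has_induced_path 4 E"
proof -
  have "inj_on g {..<4}" by (auto simp: inj_on_def g_eq)
  moreover have "\<forall>i<4. \<forall>j<4. E (g i) (g j) \<longleftrightarrow> path_adj i j"
    by (auto simp: adj_g cycle_adj_def path_adj_def mod_Suc)
  ultimately show ?thesis unfolding has_induced_path_def by blast
qed

lemma independence: "independence_number E = 2"
  unfolding independence_number_def
proof (rule Max_eqI[OF finite_independent_cards])
  have "independent_set E {g 0, g 2}" by (simp add: independent_set_def adj_g cycle_adj_def)
  moreover have "card {g 0, g 2} = 2" by (simp add: g_eq)
  ultimately show "2 \<in> {card S | S. independent_set E S}" by (metis (mono_tags, lifting) mem_Collect_eq)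
next
  fix k assume "k \<in> {card S | S. independent_set E S}"
  then obtain S where S: "independent_set E S" "k = card S" by blast
  have triple: "\<forall>u v w. u = v \<or> v = w \<or> u = w \<or> E u v \<or> E v w \<or> E u w"
    unfolding all_vertices by (simp add: adj_g g_eq cycle_adj_def)
  show "k \<le> 2"
  proof (rule ccontr)
    assume "\<not> k \<le> 2"
    then have "3 \<le> card S" using S by simp
    then obtain T where "T \<subseteq> S" "card T = 3" using obtain_subset_with_card_n by metis
    then obtain u v w where "u \<in> S" "v \<in> S" "w \<in> S" "u \<noteq> v" "v \<noteq> w" "u \<noteq> w"
      unfolding card_3_iff by auto
    then show False using S(1) triple unfolding independent_set_def by blast
  qed
qed

lemma diameter: "graph_diameter E = 2"
  unfolding graph_diameter_def
proof (rule Max_eqI[OF finite_graph_dists])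
  have le: "\<forall>u v. graph_dist E u v \<le> 2"
  proof -
    \<comment> \<open>The existential is written as a negated universal so that
      \<open>all_vertices\<close> unfolds it as well.\<close>
    have "\<forall>u v. u = v \<or> E u v \<or> \<not> (\<forall>w. \<not> (E u w \<and> E w v))"
      unfolding all_vertices by (simp add: adj_g g_eq cycle_adj_def)
    then show ?thesis by (simp add: graph_dist_le_2_iff[OF conn])
  qed
  then show "k \<le> 2" if "k \<in> {graph_dist E u v | u v. True}" for k
    using that by auto
  have pow: "(E ^^ graph_dist E (g 0) (g 2)) (g 0) (g 2)"
    unfolding graph_dist_def
    by (rule LeastI_ex) (use conn in \<open>simp add: connected_graph_def rtranclp_is_Sup_relpowp\<close>)
  have "\<not> E (g 0) (g 2)" "g 0 \<noteq> g 2" by (simp_all add: adj_g g_eq cycle_adj_def)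
  then have "graph_dist E (g 0) (g 2) \<noteq> 0" "graph_dist E (g 0) (g 2) \<noteq> 1"
    using pow by (auto simp: relcompp_apply intro: ccontr)
  then have "graph_dist E (g 0) (g 2) = 2" using le by (metis One_nat_def le_SucE le_zero_eq numeral_2_eq_2)
  then show "2 \<in> {graph_dist E u v | u v. True}" by (metis (mono_tags, lifting) mem_Collect_eq)
qed

lemma laplacian_component:
  "(normalized_laplacian E *v w) $ u = w $ u - (\<Sum>v | E u v. w $ v) / 2"
proof -
  have "\<not> E u u" using simple by (simp add: simple_graph_def irreflp_def)
  then have "(normalized_laplacian E *v w) $ u
      = (\<Sum>v\<in>UNIV. (if u = v then w $ v else 0) - (if E u v then w $ v else 0) / 2)"
    unfolding matrix_vector_mult_def normalized_laplacian_def
    by (auto simp: degree_2 intro!: sum.cong)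
  also have "\<dots> = w $ u - (\<Sum>v | E u v. w $ v) / 2"
    by (simp add: sum_subtractf sum.If_cases flip: sum_divide_distrib)
  finally show ?thesis .
qed

text \<open>Since the cycle is 2-regular, L = I - A/2, so the parameter t is an eigenvalue of the
  adjacency matrix.\<close>

lemma eigenvector_iff:
  "normalized_laplacian E *v w = (1 - t / 2) *\<^sub>R w \<longleftrightarrow>
     w $ g 1 + w $ g 4 = t * w $ g 0 \<and> w $ g 0 + w $ g 2 = t * w $ g 1 \<and>
     w $ g 1 + w $ g 3 = t * w $ g 2 \<and> w $ g 2 + w $ g 4 = t * w $ g 3 \<and>
     w $ g 0 + w $ g 3 = t * w $ g 4"
proof -
  have "(a - s / 2 = (1 - t / 2) * a) = (s = t * a)" for a s :: real
    by (auto simp: field_simps)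
  then show ?thesis
    unfolding vec_eq_iff laplacian_component all_vertices neighbours vector_scaleR_component
    by (simp add: g_eq)
qed

lemma multiplicity_golden:
  assumes t: "t\<^sup>2 + t = 1"
  shows "count (nl_spectrum E) (1 - t / 2) \<ge> 2"
proof -
  \<comment> \<open>Both vectors follow the recurrence z_(i+1) = t z_i - z_(i-1), started at (1, 0)
    and (0, 1); t^2 + t = 1 makes them close up after five steps.\<close>
  define v where "v = (\<chi> u. [1, 0, -1, -t, t] ! f u)"
  define w where "w = (\<chi> u. [0, 1, t, -t, -1] ! f u)"
  let ?K = "{v. normalized_laplacian E *v v = (1 - t / 2) *\<^sub>R v}"
  have t2: "t * t = 1 - t" using t by (simp add: power2_eq_square)
  have v: "v $ g 0 = 1" "v $ g 1 = 0" "v $ g 2 = -1" "v $ g 3 = -t" "v $ g 4 = t"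
    and w: "w $ g 0 = 0" "w $ g 1 = 1" "w $ g 2 = t" "w $ g 3 = -t" "w $ g 4 = -1"
    by (simp_all add: v_def w_def)
  have sub: "{v, w} \<subseteq> ?K" by (simp add: eigenvector_iff v w t2 del: One_nat_def)
  have "v \<noteq> w" using v(1) w(1) by auto
  moreover have "v \<notin> span {w}"
  proof
    assume "v \<in> span {w}"
    then obtain k where "v - k *\<^sub>R w = 0" unfolding span_breakdown_eq span_empty by blast
    from arg_cong[OF this, of "\<lambda>x. x $ g 0"] show False by (simp add: v w)
  qed
  moreover have "w \<noteq> 0" using w(2) by auto
  ultimately have "independent {v, w}" "card {v, w} = 2" by (auto simp: independent_insert)
  then have "2 \<le> dim ?K" using independent_card_le_dim[OF sub] by simp
  then show ?thesis by (simp add: count_nl_spectrum[OF simple])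
qed

text \<open>At t = 0 the values at distance two are opposite. Five such steps return to the start,
  so each value equals its own negative.\<close>

lemma one_not_in_spectrum: "1 \<notin># nl_spectrum E"
proof -
  have "w = 0" if "normalized_laplacian E *v w = (1 - 0 / 2) *\<^sub>R w" for w
    using that unfolding eigenvector_iff by (auto simp: vec_eq_iff all_vertices)
  then have "{w. normalized_laplacian E *v w = 1 *\<^sub>R w} = {0}" by auto
  then have "count (nl_spectrum E) 1 = 0" by (simp add: count_nl_spectrum[OF simple])
  then show ?thesis by (simp add: not_in_iff)
qed

text \<open>The two roots of t^2 + t = 1 contribute at least two eigenvalues each, so the list has
  length at least 4 and the index 4 - 1 is in range; the entry is then a genuine eigenvalue, and 1
  is none.\<close>

lemma eigenvalue_4: "nl_eigenvalue E 4 \<noteq> 1"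
proof -
  let ?t = "(-1 + sqrt 5) / 2" and ?t' = "(-1 - sqrt 5) / 2"
  let ?R = "replicate_mset 2 (1 - ?t / 2) + replicate_mset 2 (1 - ?t' / 2)"
  have "2 \<le> count (nl_spectrum E) (1 - ?t / 2)" "2 \<le> count (nl_spectrum E) (1 - ?t' / 2)"
    by (rule multiplicity_golden; simp add: power2_eq_square field_simps)+
  then have "?R \<subseteq># nl_spectrum E" by (intro mset_subset_eqI) auto
  from size_mset_mono[OF this] have "size (nl_spectrum E) \<ge> 4" by simp
  moreover have "mset (sorted_list_of_multiset (nl_spectrum E)) = nl_spectrum E" by simp
  ultimately have "length (sorted_list_of_multiset (nl_spectrum E)) \<ge> 4" by (metis size_mset)
  then have "nl_eigenvalue E 4 \<in> set (rev (sorted_list_of_multiset (nl_spectrum E)))"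
    unfolding nl_eigenvalue_def by (intro nth_mem) simp
  then have "nl_eigenvalue E 4 \<in># nl_spectrum E" by simp
  then show ?thesis using one_not_in_spectrum by auto
qed

end

theorem theorem1p2:
  fixes E :: "'v::finite \<Rightarrow> 'v \<Rightarrow> bool" and n :: nat
  assumes "n = CARD('v)" and "n \<ge> 5"
    and "simple_graph E" and "connected_graph E"
    and "\<exists>\<theta>. \<theta> \<in># nl_spectrum E \<and> count (nl_spectrum E) \<theta> = n - 3"
  shows "has_induced_path 4 E \<and> nl_eigenvalue E (n - 1) \<noteq> 1
           \<and> independence_number E = 2 \<and> graph_diameter E = 2
         \<longleftrightarrow> isomorphic_to_cycle 5 E"
proof
  obtain \<theta> where "count (nl_spectrum E) \<theta> = CARD('v) - 3" using assms by blast
  then show "isomorphic_to_cycle 5 E"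
    if "has_induced_path 4 E \<and> nl_eigenvalue E (n - 1) \<noteq> 1
           \<and> independence_number E = 2 \<and> graph_diameter E = 2"
    using diameter_2_imp_C5 assms that by blast
next
  assume "isomorphic_to_cycle 5 E"
  then obtain f where "bij_betw f UNIV {..<5}" "\<forall>u v. E u v \<longleftrightarrow> cycle_adj 5 (f u) (f v)"
    unfolding isomorphic_to_cycle_def by blast
  then interpret five_cycle E f "inv_into UNIV f"
    using assms by unfold_locales auto
  show "has_induced_path 4 E \<and> nl_eigenvalue E (n - 1) \<noteq> 1
           \<and> independence_number E = 2 \<and> graph_diameter E = 2"
    using induced_path independence diameter eigenvalue_4 order_5 assms(1) by simp
qed

end
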